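(* Let $X$ and $Y$ be $\mathbb{R}^d$-valued normal vectors with distributions $X\sim\mathrm{MVN}(0,\Sigma)$ and $Y\sim\mathrm{MVN}(0,\Sigma_0)$, where $\Sigma=(\sigma_{i,j})_{i,j=1,\dots,d}$ has full rank, and $\Sigma_0=(\sigma^0_{i,j})_{i,j=1,\dots,d}$ is nonnegative definite. Let $h:\mathbb{R}^d\to\mathbb{R}$ have $2$ bounded derivatives. Then $$|\mathbb{E}h(X)-\mathbb{E}h(Y)|\le\frac12|h|_2\sum_{i,j=1}^d|\sigma_{i,j}-\sigma^0_{i,j}|.$$
   Context: $\mathrm{MVN}(0,\Sigma)$ denotes the (possibly singular) multivariate normal distribution with mean vector $0$ and covariance matrix $\Sigma$. $|h|_2:=\sup_{i,j}\|\partial^2h/\partial x_i\partial x_j\|$, with $\|\cdot\|$ the supremum norm. "$h$ has 2 bounded derivatives" means that $h$ is twice differentiable with bounded first and second order partial derivatives. *)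

theory Defs
  imports "HOL-Probability.Probability"
begin

text \<open>Standard normal law on \<open>real ^ 'n\<close>: the joint law of independent \<open>N(0,1)\<close> coordinates.\<close>

definition std_normal_vec :: "(real ^ 'n) measure" where
  "std_normal_vec =
     distr (\<Pi>\<^sub>M i\<in>(UNIV :: 'n set). density lborel (\<lambda>t. ennreal (std_normal_density t))) borel
       (\<lambda>z. \<chi> i. z i)"

text \<open>
  \<open>X\<close> has distribution \<open>MVN(\<mu>, \<Sigma>)\<close> if it is equal in law to \<open>\<mu> + A Z\<close>, where \<open>Z\<close> is standard
  normal and \<open>A A\<^sup>T = \<Sigma>\<close>. A singular \<open>A\<close> is allowed, so degenerate normal laws (including point
  masses) are covered. The law does not depend on the choice of the factor \<open>A\<close>, and each symmetric
  nonnegative definite \<open>\<Sigma>\<close> has a square one.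
\<close>

definition has_mvn :: "'a measure \<Rightarrow> ('a \<Rightarrow> real ^ 'n) \<Rightarrow> real ^ 'n \<Rightarrow> real ^ 'n ^ 'n \<Rightarrow> bool" where
  "has_mvn M X \<mu> \<Sigma> \<longleftrightarrow>
     X \<in> borel_measurable M \<and>
     (\<exists>A :: real ^ 'n ^ 'n. A ** transpose A = \<Sigma> \<and>
        distr M borel X = distr std_normal_vec borel (\<lambda>z. \<mu> + A *v z))"

definition nonneg_definite :: "real ^ 'n ^ 'n \<Rightarrow> bool" where
  "nonneg_definite S \<longleftrightarrow> transpose S = S \<and> (\<forall>x. 0 \<le> x \<bullet> (S *v x))"

definition partial :: "'n \<Rightarrow> (real ^ 'n \<Rightarrow> real) \<Rightarrow> real ^ 'n \<Rightarrow> real" where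
  "partial i f x = deriv (\<lambda>t. f (x + t *\<^sub>R axis i 1)) 0"

text \<open>
  Twice differentiability is in the Frechet sense; in finite dimension, the derivative of \<open>h\<close> is
  differentiable iff all partial derivatives of \<open>h\<close> are. \<open>h\<close> itself need not be bounded.
\<close>

definition two_bounded_derivs :: "(real ^ 'n \<Rightarrow> real) \<Rightarrow> bool" where
  "two_bounded_derivs h \<longleftrightarrow>
     (\<forall>x. h differentiable (at x)) \<and>
     (\<forall>i x. partial i h differentiable (at x)) \<and>
     (\<forall>i. bounded (range (partial i h))) \<and>
     (\<forall>i j. bounded (range (partial i (partial j h))))"

definition sup_norm :: "('a \<Rightarrow> real) \<Rightarrow> real" where
  "sup_norm f = (SUP x. \<bar>f x\<bar>)"

text \<open>
  \<open>Sup\<close> on \<open>real\<close> is meaningful only for nonempty sets bounded above, so this is the intended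
  quantity only for functions with bounded second order partial derivatives.
\<close>

definition seminorm2 :: "(real ^ 'n \<Rightarrow> real) \<Rightarrow> real" where
  "seminorm2 h = (SUP (i, j) \<in> UNIV. sup_norm (partial i (partial j h)))"

end

theory Submission
  imports Defs
begin

text \<open>
  Realize \<open>X = P Z\<close> and \<open>Y = Q Z\<close> with the same standard normal \<open>Z\<close> in dimension \<open>2d\<close>, independently,
  that is \<open>P Q\<^sup>T = 0\<close>, and rotate one into the other: \<open>F t = E h (W t)\<close> for
  \<open>W t = cos t X + sin t Y\<close>. Stein's identity \<open>E (Z\<^sub>k f Z) = E (\<partial>\<^sub>k f Z)\<close>, applied to the partial
  derivatives of \<open>h\<close>, turns \<open>F' t = E (W' t \<bullet> \<nabla>h (W t))\<close> into \<open>sin t cos t\<close> times the sum of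
  \<open>(\<sigma>\<^sup>0\<^sub>i\<^sub>j - \<sigma>\<^sub>i\<^sub>j) E \<partial>\<^sub>i\<partial>\<^sub>j h (W t)\<close>, and the integral of \<open>sin t cos t\<close> over \<open>[0, \<pi>/2]\<close> is \<open>1/2\<close>.
  The rotation (instead of weights \<open>\<surd>t\<close> and \<open>\<surd>(1 - t)\<close>) has no singularity at the end points. The
  second derivatives need not be continuous, so the fundamental theorem of calculus is used for the
  Henstock-Kurzweil integral and the bound on \<open>F'\<close> is integrated by monotonicity.
\<close>

section \<open>The one-dimensional standard normal law and Stein's identity\<close>

abbreviation std_normal :: "real measure" where
  "std_normal \<equiv> density lborel (\<lambda>t. ennreal (std_normal_density t))"

lemma prob_space_std_normal: "prob_space std_normal"
  by (rule prob_space_normal_density) simp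

lemma integrable_std_normal_id: "integrable std_normal (\<lambda>x. x)"
  using integrable_std_normal_moment[of 1] by (simp add: integrable_density)

text \<open>The derivative is the pointwise limit of difference quotients with steps
  \<open>1 / (n + 1)\<close>, each of which is Borel. This covers derivatives that may be
  discontinuous, such as the second order partial derivatives of \<open>h\<close>.\<close>

lemma borel_measurable_directional_deriv:
  fixes f :: "'a::euclidean_space \<Rightarrow> real"
  assumes f: "f \<in> borel_measurable borel"
    and deriv: "\<And>x. ((\<lambda>t. f (x + t *\<^sub>R v)) has_real_derivative g x) (at 0)"
  shows "g \<in> borel_measurable borel"
proof (rule borel_measurable_LIMSEQ_real)
  show "(\<lambda>n. (f (x + inverse (real (Suc n)) *\<^sub>R v) - f x) / inverse (real (Suc n))) \<longlonglongrightarrow> g x" for x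
  proof -
    have "((\<lambda>t. (f (x + t *\<^sub>R v) - f x) / t) \<longlongrightarrow> g x) (at 0)"
      using deriv[of x] by (simp add: has_field_derivative_iff)
    moreover have "filterlim (\<lambda>n. inverse (real (Suc n))) (at 0) sequentially"
      using LIMSEQ_inverse_real_of_nat by (auto simp: filterlim_at)
    ultimately show ?thesis
      by (rule filterlim_compose)
  qed
  show "(\<lambda>x. (f (x + inverse (real (Suc n)) *\<^sub>R v) - f x) / inverse (real (Suc n))) \<in> borel_measurable borel" for n
    using f by measurable
qed

lemma std_normal_density_tendsto_0: "(\<lambda>n. std_normal_density (real n)) \<longlonglongrightarrow> 0"
proof -
  have "filterlim (\<lambda>n. (real n)\<^sup>2 / 2) at_top sequentially"
  proof (rule filterlim_at_top_mono)
    show "filterlim (\<lambda>n. - 1 / 2 + real n) at_top sequentially"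
      by (rule filterlim_tendsto_add_at_top[OF tendsto_const filterlim_real_sequentially])
    \<comment> \<open>Expanding \<open>(n - 1)\<^sup>2 \<ge> 0\<close> bounds the quadratic exponent
      below by a linear function.\<close>
    have "- 1 / 2 + real n \<le> (real n)\<^sup>2 / 2" for n
      using zero_le_power2[of "real n - 1"] by (simp add: power2_diff)
    then show "\<forall>\<^sub>F n in sequentially. - 1 / 2 + real n \<le> (real n)\<^sup>2 / 2"
      by simp
  qed
  then have "(\<lambda>n. exp (- ((real n)\<^sup>2 / 2))) \<longlonglongrightarrow> 0"
    by (intro filterlim_compose[OF exp_at_bot]) (simp add: filterlim_uminus_at_top)
  from tendsto_mult_right_zero[OF this, of "1 / sqrt (2 * pi)"] show ?thesis
    by (simp add: std_normal_density_def)
qed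

text \<open>The density \<open>p\<close> satisfies \<open>p' x = - x * p x\<close>, so
  \<open>p * f\<close> has derivative \<open>p x * (f' x - x * f x)\<close>. This derivative
  integrates to zero over the line because \<open>p\<close> vanishes at infinity and
  \<open>f\<close> is bounded.\<close>

lemma stein_identity_real:
  fixes f f' :: "real \<Rightarrow> real"
  assumes deriv: "\<And>x. (f has_real_derivative f' x) (at x)"
    and f_le: "\<And>x. \<bar>f x\<bar> \<le> C" and f'_le: "\<And>x. \<bar>f' x\<bar> \<le> D"
  shows "(\<integral>x. x * f x \<partial>std_normal) = (\<integral>x. f' x \<partial>std_normal)"
proof -
  interpret prob_space std_normal by (rule prob_space_std_normal)
  have f_meas[measurable]: "f \<in> borel_measurable borel"
    using deriv by (intro borel_measurable_continuous_onI DERIV_continuous_on) (auto intro: DERIV_subset)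
  \<comment> \<open>Measurability of \<open>f'\<close> comes from the case of direction
    \<open>1\<close> on the line, since \<open>f'\<close> need not be continuous.\<close>
  have "((\<lambda>t. f (x + t *\<^sub>R 1)) has_real_derivative f' x) (at 0)" for x
    using deriv[of x] using DERIV_shift[of f "f' x" 0 x] by (simp add: add.commute)
  from borel_measurable_directional_deriv[OF f_meas this]
  have f'_meas[measurable]: "f' \<in> borel_measurable borel" .
  let ?g = "\<lambda>x. std_normal_density x * f x"
  let ?g' = "\<lambda>x. std_normal_density x * (f' x - x * f x)"
  have int_f': "integrable std_normal f'"
    using f'_le by (intro integrable_const_bound[where B = D]) auto
  have int_xf: "integrable std_normal (\<lambda>x. x * f x)"
  proof (rule Bochner_Integration.integrable_bound)
    show "integrable std_normal (\<lambda>x. C * x)"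
      using integrable_std_normal_id by simp
    show "AE x in std_normal. norm (x * f x) \<le> norm (C * x)"
      using f_le abs_ge_self by (auto simp: abs_mult mult.commute[of C] intro!: mult_left_mono order_trans[OF f_le])
  qed simp
  have int: "integrable lborel ?g'"
    using Bochner_Integration.integrable_diff[OF int_f' int_xf]
    by (subst (asm) integrable_density) auto
  have g_deriv: "(?g has_real_derivative ?g' x) (at x)" for x
  proof -
    have "((\<lambda>x. exp (- x\<^sup>2 / 2)) has_real_derivative exp (- x\<^sup>2 / 2) * - x) (at x)"
      by (auto intro!: derivative_eq_intros)
    from DERIV_cmult[OF this, of "1 / sqrt (2 * pi)"]
    have "(std_normal_density has_real_derivative std_normal_density x * - x) (at x)"
      by (simp add: std_normal_density_def[abs_def])
    from DERIV_mult[OF this deriv[of x]] show ?thesis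
      by (simp add: algebra_simps)
  qed
  have FTC: "(LINT x|lborel. indicator {- real n..real n} x *\<^sub>R ?g' x) = ?g (real n) - ?g (- real n)" for n
  proof -
    \<comment> \<open>For the Henstock-Kurzweil integral it is enough that \<open>?g\<close> is
      differentiable at every point. As \<open>?g'\<close> is also Lebesgue integrable, the value
      carries over to the Lebesgue integral.\<close>
    have has_int: "(?g' has_integral (?g (real n) - ?g (- real n))) {- real n..real n}"
      using g_deriv
      by (intro fundamental_theorem_of_calculus)
        (auto simp: has_real_derivative_iff_has_vector_derivative[symmetric] intro: DERIV_subset)
    have set_int: "set_integrable lborel {- real n..real n} ?g'"
      unfolding set_integrable_def using int by (intro integrable_mult_indicator) auto
    show ?thesis
      using trans[OF set_borel_integral_eq_integral(2)[OF set_int] integral_unique[OF has_int]]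
      by (simp only: set_lebesgue_integral_def)
  qed
  have "(\<lambda>n. LINT x|lborel. indicator {- real n..real n} x *\<^sub>R ?g' x) \<longlonglongrightarrow> (LINT x|lborel. ?g' x)"
  proof (rule integral_dominated_convergence[where w = "\<lambda>x. \<bar>?g' x\<bar>"])
    show "integrable lborel (\<lambda>x. \<bar>?g' x\<bar>)" using int by simp
    show "AE x in lborel. (\<lambda>n. indicator {- real n..real n} x *\<^sub>R ?g' x) \<longlonglongrightarrow> ?g' x"
    proof (intro AE_I2 tendsto_eventually)
      fix x :: real
      obtain n0 :: nat where "\<bar>x\<bar> \<le> real n0" using real_arch_simple by blast
      then show "\<forall>\<^sub>F n in sequentially. indicator {- real n..real n} x *\<^sub>R ?g' x = ?g' x"
        by (intro eventually_sequentiallyI[of n0]) (auto simp: indicator_def abs_le_iff)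
    qed
  qed (auto simp: indicator_def)
  moreover have "(\<lambda>n. ?g (real n) - ?g (- real n)) \<longlonglongrightarrow> 0"
  proof (rule Lim_null_comparison)
    have "norm (?g (real n) - ?g (- real n)) = std_normal_density (real n) * \<bar>f (real n) - f (- real n)\<bar>" for n
    proof -
      have "std_normal_density (- real n) = std_normal_density (real n)"
        by (simp add: std_normal_density_def)
      then show ?thesis
        by (simp add: abs_mult flip: right_diff_distrib)
    qed
    moreover have "\<bar>f (real n) - f (- real n)\<bar> \<le> 2 * C" for n
      using f_le[of "real n"] f_le[of "- real n"] by linarith
    ultimately show "\<forall>\<^sub>F n in sequentially. norm (?g (real n) - ?g (- real n)) \<le> std_normal_density (real n) * (2 * C)"
      by (simp add: mult_left_mono)
    show "(\<lambda>n. std_normal_density (real n) * (2 * C)) \<longlonglongrightarrow> 0"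
      using tendsto_mult_left_zero[OF std_normal_density_tendsto_0] .
  qed
  ultimately have "(LINT x|lborel. ?g' x) = 0"
    unfolding FTC by (simp add: LIMSEQ_unique)
  then have "(\<integral>x. f' x - x * f x \<partial>std_normal) = 0"
    by (subst integral_density) auto
  then show ?thesis
    using int_f' int_xf by simp
qed

section \<open>Standard normal vectors: integrability, Stein's identity, choice of
  coordinates\<close>

lemma measurable_vec_lambda_PiM [measurable]:
  "(\<lambda>z. \<chi> i. z i) \<in> (\<Pi>\<^sub>M i\<in>(UNIV :: 'n::finite set). std_normal) \<rightarrow>\<^sub>M (borel :: (real ^ 'n) measure)"
  by (subst borel_measurable_euclidean_space)
    (auto simp: Basis_vec_def inner_axis intro!: borel_measurable_inner)

lemma sets_std_normal_vec [simp, measurable_cong]: "sets std_normal_vec = sets borel"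
  by (simp add: std_normal_vec_def)

lemma space_std_normal_vec [simp]: "space std_normal_vec = UNIV"
  by (simp add: std_normal_vec_def)

lemma prob_space_std_normal_vec: "prob_space std_normal_vec"
  unfolding std_normal_vec_def
  by (intro prob_space.prob_space_distr measurable_vec_lambda_PiM prob_space_PiM prob_space_std_normal)

text \<open>Each coordinate of the product measure has law \<open>std_normal\<close>, whose first
  moment is finite.\<close>

lemma integrable_std_normal_vec_nth: "integrable std_normal_vec (\<lambda>z. z $ k)"
proof -
  let ?P = "\<Pi>\<^sub>M i\<in>(UNIV :: 'a set). std_normal"
  have "distr ?P std_normal (\<lambda>\<omega>. \<omega> k) = std_normal"
    by (rule distr_PiM_component) (auto intro: prob_space_std_normal)
  then have "integrable (distr ?P std_normal (\<lambda>\<omega>. \<omega> k)) (\<lambda>x. x)"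
    using integrable_std_normal_id by simp
  then have "integrable ?P (\<lambda>\<omega>. \<omega> k)"
    by (rule integrable_distr[rotated]) measurable
  then show ?thesis
    unfolding std_normal_vec_def by (subst integrable_distr_eq) auto
qed

lemma integrable_std_normal_vec_bounded:
  assumes "f \<in> borel_measurable borel" and "\<And>z. \<bar>f z\<bar> \<le> (C::real)"
  shows "integrable std_normal_vec f"
proof -
  interpret prob_space std_normal_vec by (rule prob_space_std_normal_vec)
  show ?thesis
    using assms by (intro integrable_const_bound[where B = C]) auto
qed

lemma integrable_std_normal_vec_nth_mult:
  assumes [measurable]: "f \<in> borel_measurable borel" and le: "\<And>z. \<bar>f z\<bar> \<le> (C::real)"
  shows "integrable std_normal_vec (\<lambda>z. z $ k * f z)"
proof (rule Bochner_Integration.integrable_bound)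
  show "integrable std_normal_vec (\<lambda>z. C * z $ k)"
    by (intro integrable_mult_right integrable_std_normal_vec_nth)
  show "AE z in std_normal_vec. norm (z $ k * f z) \<le> norm (C * z $ k)"
    using abs_ge_self by (auto simp: abs_mult mult.commute[of C] intro!: mult_left_mono order_trans[OF le])
qed simp

text \<open>By Fubini, coordinate \<open>k\<close> is integrated first with all others frozen, and
  the one-dimensional identity applies to every such slice.\<close>

lemma stein_identity:
  fixes f g :: "real ^ 'n \<Rightarrow> real"
  assumes f_meas[measurable]: "f \<in> borel_measurable borel"
    and deriv: "\<And>z. ((\<lambda>t. f (z + t *\<^sub>R axis k 1)) has_real_derivative g z) (at 0)"
    and f_le: "\<And>z. \<bar>f z\<bar> \<le> C" and g_le: "\<And>z. \<bar>g z\<bar> \<le> D"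
  shows "(\<integral>z. z $ k * f z \<partial>std_normal_vec) = (\<integral>z. g z \<partial>std_normal_vec)"
proof -
  interpret product_sigma_finite "\<lambda>_::'n. std_normal"
    by (intro product_sigma_finite.intro prob_space_imp_sigma_finite prob_space_std_normal)
  have g_meas[measurable]: "g \<in> borel_measurable borel"
    using borel_measurable_directional_deriv[OF f_meas deriv] .
  let ?P = "Pi\<^sub>M (- {k}) (\<lambda>_. std_normal)"
  have split: "(\<integral>z. F z \<partial>std_normal_vec) = (\<integral>x. (\<integral>y. F (\<chi> i. if i = k then y else x i) \<partial>std_normal) \<partial>?P)"
    if F: "integrable std_normal_vec F" for F :: "real ^ 'n \<Rightarrow> real"
  proof -
    have [measurable]: "F \<in> borel_measurable borel"
      using borel_measurable_integrable[OF F] by (simp add: measurable_def)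
    have ins: "insert k (- {k}) = UNIV"
      by auto
    have "integrable (Pi\<^sub>M UNIV (\<lambda>_. std_normal)) (\<lambda>x. F (\<chi> i. x i))"
      using F unfolding std_normal_vec_def by (subst (asm) integrable_distr_eq) auto
    from product_integral_insert[of "- {k}" k, unfolded ins, OF _ _ this]
    show ?thesis
      unfolding std_normal_vec_def fun_upd_def by (subst integral_distr) auto
  qed
  have inner: "(\<integral>y. (\<chi> i. if i = k then y else x i) $ k * f (\<chi> i. if i = k then y else x i) \<partial>std_normal) =
      (\<integral>y. g (\<chi> i. if i = k then y else x i) \<partial>std_normal)" for x
  proof -
    have shift: "(\<chi> i. if i = k then y else x i) + t *\<^sub>R axis k 1 = (\<chi> i. if i = k then t + y else x i)" for y t
      by (simp add: vec_eq_iff axis_def)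
    \<comment> \<open>\<open>deriv\<close> speaks of the parameter \<open>0\<close> only, but for
      every base point; taking the base point on the slice and shifting the parameter gives the
      derivative at each \<open>y\<close>.\<close>
    have "((\<lambda>y. f (\<chi> i. if i = k then y else x i)) has_real_derivative g (\<chi> i. if i = k then y else x i)) (at y)" for y
      using deriv[of "\<chi> i. if i = k then y else x i"] DERIV_shift[of "\<lambda>y. f (\<chi> i. if i = k then y else x i)" _ 0 y]
      unfolding shift by simp
    from stein_identity_real[OF this f_le g_le] show ?thesis
      by simp
  qed
  show ?thesis
    using split[OF integrable_std_normal_vec_nth_mult[OF f_meas f_le]]
      split[OF integrable_std_normal_vec_bounded[OF g_meas g_le]] inner by simp
qed

text \<open>Distinct coordinates of a product measure are independent with the same factors. This
  allows two standard normal vectors to be read off disjoint blocks of coordinates of one larger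
  vector.\<close>

lemma distr_std_normal_vec_reindex:
  fixes r :: "'n::finite \<Rightarrow> 'm::finite"
  assumes "inj r"
  shows "distr std_normal_vec borel (\<lambda>z. \<chi> i. z $ r i) = std_normal_vec"
proof -
  let ?P = "\<Pi>\<^sub>M i\<in>(UNIV :: 'n set). std_normal" and ?Q = "\<Pi>\<^sub>M i\<in>(UNIV :: 'm set). std_normal"
  have [measurable]: "(\<lambda>z. \<chi> i. z $ r i) \<in> borel_measurable (borel :: (real ^ 'm) measure)"
    by (intro borel_measurable_continuous_onI continuous_intros)
  have [measurable]: "(\<lambda>\<omega> i. \<omega> (r i)) \<in> ?Q \<rightarrow>\<^sub>M ?P"
    by (rule measurable_PiM_single') auto
  have "distr ?Q ?P (\<lambda>\<omega>. \<lambda>i\<in>UNIV. \<omega> (r i)) = ?P"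
    using assms by (intro distr_PiM_reindex prob_space_std_normal) auto
  then have P: "distr ?Q ?P (\<lambda>\<omega> i. \<omega> (r i)) = ?P"
    by (simp add: restrict_UNIV)
  have "std_normal_vec = distr (distr ?Q ?P (\<lambda>\<omega> i. \<omega> (r i))) borel (\<lambda>z. \<chi> i. z i)"
    unfolding P by (simp add: std_normal_vec_def)
  also have "\<dots> = distr ?Q borel (\<lambda>\<omega>. \<chi> i. \<omega> (r i))"
    by (subst distr_distr) (auto simp: comp_def)
  also have "\<dots> = distr std_normal_vec borel (\<lambda>z. \<chi> i. z $ r i)"
    unfolding std_normal_vec_def by (subst distr_distr) (auto simp: comp_def)
  finally show ?thesis ..
qed

section \<open>Differentiation under the integral sign\<close>

text \<open>The Lipschitz bound \<open>w\<close> at the fixed point \<open>t\<close> dominates all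
  difference quotients. Dominated convergence applies to sequences, so the limit is tested along
  arbitrary sequences that tend to \<open>t\<close> and avoid it.\<close>

lemma has_real_derivative_integral:
  fixes f :: "real \<Rightarrow> 'a \<Rightarrow> real"
  assumes int: "\<And>s. integrable M (f s)" and [measurable]: "f' \<in> borel_measurable M"
    and deriv: "\<And>z. ((\<lambda>s. f s z) has_real_derivative f' z) (at t)"
    and lip: "\<And>s z. \<bar>f s z - f t z\<bar> \<le> w z * \<bar>s - t\<bar>" and w: "integrable M w"
  shows "((\<lambda>s. \<integral>z. f s z \<partial>M) has_real_derivative (\<integral>z. f' z \<partial>M)) (at t)"
  unfolding has_field_derivative_iff tendsto_at_iff_sequentially
proof (intro allI impI)
  fix s :: "nat \<Rightarrow> real"
  assume s: "\<forall>i. s i \<in> UNIV - {t}" "s \<longlonglongrightarrow> t"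
  have [measurable]: "f u \<in> borel_measurable M" for u
    using int by (rule borel_measurable_integrable)
  have "(\<lambda>n. \<integral>z. (f (s n) z - f t z) / (s n - t) \<partial>M) \<longlonglongrightarrow> (\<integral>z. f' z \<partial>M)"
  proof (rule integral_dominated_convergence)
    show "integrable M w" by (rule w)
    show "AE z in M. (\<lambda>n. (f (s n) z - f t z) / (s n - t)) \<longlonglongrightarrow> f' z"
      using deriv s unfolding has_field_derivative_iff tendsto_at_iff_sequentially by (auto simp: comp_def)
    show "AE z in M. norm ((f (s n) z - f t z) / (s n - t)) \<le> w z" for n
      using lip[of "s n"] s by (auto simp: abs_divide divide_le_eq)
  qed measurable
  then show "((\<lambda>y. ((\<integral>z. f y z \<partial>M) - (\<integral>z. f t z \<partial>M)) / (y - t)) \<circ> s) \<longlonglongrightarrow> (\<integral>z. f' z \<partial>M)"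
    using int by (simp add: comp_def)
qed

section \<open>Partial derivatives and the chain rule\<close>

text \<open>A linear map is determined by its values on the standard basis, and restricting
  \<open>f\<close> to a coordinate line through \<open>x\<close> identifies these values with the
  partial derivatives.\<close>

lemma has_derivative_partial:
  fixes f :: "real ^ 'n \<Rightarrow> real"
  assumes "f differentiable (at x)"
  shows "(f has_derivative (\<lambda>v. \<Sum>i\<in>UNIV. v $ i * partial i f x)) (at x)"
proof -
  obtain D where D: "(f has_derivative D) (at x)"
    using assms by (auto simp: differentiable_def)
  interpret bounded_linear D by (rule has_derivative_bounded_linear[OF D])
  have partial: "partial i f x = D (axis i 1)" for i
  proof -
    have "((\<lambda>t::real. x + t *\<^sub>R axis i 1) has_derivative (\<lambda>t. t *\<^sub>R axis i 1)) (at 0)"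
      by (auto intro!: derivative_eq_intros)
    from has_derivative_compose[OF this, of f D] D
    have "((\<lambda>t. f (x + t *\<^sub>R axis i 1)) has_derivative (\<lambda>t. D (t *\<^sub>R axis i 1))) (at 0)"
      by simp
    then have "((\<lambda>t. f (x + t *\<^sub>R axis i 1)) has_real_derivative D (axis i 1)) (at 0)"
      by (rule has_derivative_imp_has_field_derivative) (simp add: scaleR mult.commute)
    then show ?thesis
      unfolding partial_def by (rule DERIV_imp_deriv)
  qed
  have "D v = (\<Sum>i\<in>UNIV. v $ i * partial i f x)" for v
  proof -
    have "D v = D (\<Sum>i\<in>UNIV. v $ i *\<^sub>R axis i 1)"
      using basis_expansion[of v] by (simp add: scalar_mult_eq_scaleR)
    also have "\<dots> = (\<Sum>i\<in>UNIV. v $ i * partial i f x)"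
      by (simp add: sum scaleR partial)
    finally show ?thesis .
  qed
  then have "D = (\<lambda>v. \<Sum>i\<in>UNIV. v $ i * partial i f x)" ..
  with D show ?thesis by simp
qed

text \<open>The chain rule along a curve, in the form used for coordinate lines, segments and the
  rotation.\<close>

lemma has_real_derivative_compose_partial:
  fixes f :: "real ^ 'n \<Rightarrow> real"
  assumes "\<And>x. f differentiable (at x)"
    and c: "(c has_vector_derivative v) (at t)"
  shows "((\<lambda>s. f (c s)) has_real_derivative (\<Sum>i\<in>UNIV. v $ i * partial i f (c t))) (at t)"
proof -
  have "((\<lambda>s. f (c s)) has_derivative (\<lambda>s. \<Sum>i\<in>UNIV. (s *\<^sub>R v) $ i * partial i f (c t))) (at t)"
    using has_derivative_compose[OF c[unfolded has_vector_derivative_def] has_derivative_partial] assms(1) .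
  then show ?thesis
    by (rule has_derivative_imp_has_field_derivative) (simp add: sum_distrib_left mult_ac)
qed

lemma borel_measurable_differentiable:
  fixes f :: "real ^ 'n \<Rightarrow> real"
  assumes "\<And>x. f differentiable (at x)"
  shows "f \<in> borel_measurable borel"
  using assms
  by (intro borel_measurable_continuous_onI continuous_at_imp_continuous_on)
    (auto intro: differentiable_imp_continuous_within)

lemma borel_measurable_partial:
  fixes f :: "real ^ 'n \<Rightarrow> real"
  assumes f: "\<And>x. f differentiable (at x)"
  shows "partial i f \<in> borel_measurable borel"
proof (rule borel_measurable_directional_deriv[OF borel_measurable_differentiable[OF f]])
  fix x
  have "((\<lambda>t. x + t *\<^sub>R axis i (1::real)) has_vector_derivative axis i 1) (at 0)"
    by (auto intro!: derivative_eq_intros)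
  from has_real_derivative_compose_partial[OF f this]
  show "((\<lambda>t. f (x + t *\<^sub>R axis i 1)) has_real_derivative partial i f x) (at 0)"
    by (simp add: axis_def if_distrib[of "\<lambda>c. c * _"] cong: if_cong)
qed

section \<open>Bounds for functions with two bounded derivatives\<close>

lemma two_bounded_derivsD:
  assumes "two_bounded_derivs h"
  shows two_bounded_derivs_differentiable: "h differentiable (at x)"
    and two_bounded_derivs_differentiable_partial: "partial i h differentiable (at x)"
  using assms by (auto simp: two_bounded_derivs_def)

lemma two_bounded_derivs_partial_bound:
  assumes "two_bounded_derivs h"
  obtains C where "\<And>i x. \<bar>partial i h x\<bar> \<le> C"
proof -
  have "bounded (\<Union>i. range (partial i h))"
    using assms by (auto simp: two_bounded_derivs_def)
  then obtain C where "\<And>y. y \<in> (\<Union>i. range (partial i h)) \<Longrightarrow> norm y \<le> C"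
    unfolding bounded_iff by blast
  then show ?thesis
    by (intro that[of C]) auto
qed

text \<open>Both suprema are genuine upper bounds: the inner one because the second derivatives are
  bounded, the outer one because it runs over finitely many index pairs.\<close>

lemma abs_partial_partial_le_seminorm2:
  assumes "two_bounded_derivs h"
  shows "\<bar>partial i (partial j h) x\<bar> \<le> seminorm2 h"
proof -
  have "bounded (range (partial i (partial j h)))"
    using assms by (auto simp: two_bounded_derivs_def)
  then have "bdd_above (range (\<lambda>x. \<bar>partial i (partial j h) x\<bar>))"
    by (auto simp: bounded_iff bdd_above_def)
  then have "\<bar>partial i (partial j h) x\<bar> \<le> sup_norm (partial i (partial j h))"
    unfolding sup_norm_def by (intro cSUP_upper) auto
  also have "\<dots> \<le> seminorm2 h"
    unfolding seminorm2_def
    using cSUP_upper[of "(i, j)" UNIV "\<lambda>(i, j). sup_norm (partial i (partial j h))"] by simp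
  finally show ?thesis .
qed

text \<open>The mean value theorem on the segment from \<open>y\<close> to \<open>x\<close>. It
  serves twice: for the linear growth that makes \<open>h\<close> integrable under a normal law, and
  for the dominating function in the derivative of the interpolation.\<close>

lemma abs_diff_le_sum_partial_bound:
  fixes f :: "real ^ 'n \<Rightarrow> real"
  assumes f: "\<And>x. f differentiable (at x)" and C: "\<And>i x. \<bar>partial i f x\<bar> \<le> C"
  shows "\<bar>f x - f y\<bar> \<le> C * (\<Sum>i\<in>UNIV. \<bar>x $ i - y $ i\<bar>)"
proof -
  have "((\<lambda>t. f (y + t *\<^sub>R (x - y))) has_real_derivative
      (\<Sum>i\<in>UNIV. (x - y) $ i * partial i f (y + t *\<^sub>R (x - y)))) (at t)" for t
    by (intro has_real_derivative_compose_partial f) (auto intro!: derivative_eq_intros)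
  from MVT2[OF zero_less_one this] obtain t where
    "f x - f y = (\<Sum>i\<in>UNIV. (x - y) $ i * partial i f (y + t *\<^sub>R (x - y)))"
    by auto
  also have "\<bar>\<dots>\<bar> \<le> (\<Sum>i\<in>UNIV. \<bar>x $ i - y $ i\<bar> * C)"
    by (intro order_trans[OF sum_abs] sum_mono) (auto simp: abs_mult intro!: mult_left_mono C)
  finally show ?thesis
    by (simp add: sum_distrib_left mult.commute)
qed

section \<open>Gaussian integration by parts and the rotation\<close>

lemma borel_measurable_matrix_vector_mult [measurable]:
  "(\<lambda>z. A *v z) \<in> borel_measurable (borel :: (real ^ 'n) measure)" for A :: "real ^ 'n ^ 'm"
  by (intro borel_measurable_continuous_onI continuous_intros)

text \<open>Expanding \<open>S *v z\<close> in coordinates leaves terms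
  \<open>z $ k * partial j h (R *v z)\<close>. Stein's identity trades the factor
  \<open>z $ k\<close> for a derivative in direction \<open>k\<close>, which by the chain rule
  brings out \<open>R $ i $ k\<close>; summing over \<open>k\<close> yields the entries of
  \<open>S ** transpose R\<close>, the cross-covariance of \<open>S *v z\<close> and
  \<open>R *v z\<close>.\<close>

lemma integral_gradient_linear_std_normal_vec:
  fixes R S :: "real ^ 'm ^ 'n"
  assumes h: "two_bounded_derivs h"
  shows "(\<integral>z. (\<Sum>j\<in>UNIV. (S *v z) $ j * partial j h (R *v z)) \<partial>std_normal_vec) =
    (\<Sum>j\<in>UNIV. \<Sum>i\<in>UNIV. (S ** transpose R) $ j $ i *
      (\<integral>z. partial i (partial j h) (R *v z) \<partial>std_normal_vec))"
proof -
  note diff = two_bounded_derivs_differentiable_partial[OF h]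
  obtain C where C: "\<And>i x. \<bar>partial i h x\<bar> \<le> C"
    using two_bounded_derivs_partial_bound[OF h] by blast
  have [measurable]: "partial j h \<in> borel_measurable borel" for j
    by (rule borel_measurable_differentiable[OF diff])
  have [measurable]: "partial i (partial j h) \<in> borel_measurable borel" for i j
    by (rule borel_measurable_partial[OF diff])
  have int2: "integrable std_normal_vec (\<lambda>z. partial i (partial j h) (R *v z))" for i j
    by (rule integrable_std_normal_vec_bounded[OF _ abs_partial_partial_le_seminorm2[OF h]]) measurable
  have int1: "integrable std_normal_vec (\<lambda>z. z $ k * partial j h (R *v z))" for k j
    by (rule integrable_std_normal_vec_nth_mult[OF _ C]) measurable
  have stein: "(\<integral>z. z $ k * partial j h (R *v z) \<partial>std_normal_vec) =
      (\<Sum>i\<in>UNIV. R $ i $ k * (\<integral>z. partial i (partial j h) (R *v z) \<partial>std_normal_vec))" for j k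
  proof -
    have "(\<integral>z. z $ k * partial j h (R *v z) \<partial>std_normal_vec) =
        (\<integral>z. (\<Sum>i\<in>UNIV. R $ i $ k * partial i (partial j h) (R *v z)) \<partial>std_normal_vec)"
    proof (rule stein_identity)
      show "\<bar>partial j h (R *v z)\<bar> \<le> C" for z by (rule C)
      show "\<bar>\<Sum>i\<in>UNIV. R $ i $ k * partial i (partial j h) (R *v z)\<bar>
          \<le> (\<Sum>i\<in>UNIV. \<bar>R $ i $ k\<bar> * seminorm2 h)" for z
        by (intro order_trans[OF sum_abs] sum_mono)
          (auto simp: abs_mult intro!: mult_left_mono abs_partial_partial_le_seminorm2[OF h])
      show "((\<lambda>t. partial j h (R *v (z + t *\<^sub>R axis k 1))) has_real_derivative
          (\<Sum>i\<in>UNIV. R $ i $ k * partial i (partial j h) (R *v z))) (at 0)" for z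
      proof -
        \<comment> \<open>Moving \<open>z\<close> in direction \<open>k\<close> moves
          \<open>R *v z\<close> in the direction of column \<open>k\<close> of
          \<open>R\<close>.\<close>
        have "((\<lambda>t. R *v z + t *\<^sub>R column k R) has_vector_derivative column k R) (at 0)"
          by (auto intro!: derivative_eq_intros)
        from has_real_derivative_compose_partial[OF diff this, of j] show ?thesis
          by (simp add: matrix_vector_right_distrib matrix_vector_mult_scaleR matrix_vector_mul_component
              matrix_vector_mult_basis column_def)
      qed
    qed measurable
    then show ?thesis
      using int2 by simp
  qed
  have "(\<integral>z. (\<Sum>j\<in>UNIV. (S *v z) $ j * partial j h (R *v z)) \<partial>std_normal_vec) =
      (\<Sum>j\<in>UNIV. \<Sum>k\<in>UNIV. S $ j $ k * (\<integral>z. z $ k * partial j h (R *v z) \<partial>std_normal_vec))"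
  proof -
    have "(S *v z) $ j = (\<Sum>k\<in>UNIV. S $ j $ k * z $ k)" for z j
      by (simp add: matrix_vector_mult_def)
    then show ?thesis
      using int1 by (simp add: sum_distrib_right mult.assoc)
  qed
  also have "\<dots> = (\<Sum>j\<in>UNIV. \<Sum>k\<in>UNIV. \<Sum>i\<in>UNIV. S $ j $ k * R $ i $ k *
      (\<integral>z. partial i (partial j h) (R *v z) \<partial>std_normal_vec))"
    by (simp add: stein sum_distrib_left mult.assoc)
  \<comment> \<open>The sum over \<open>k\<close> becomes the innermost one, so that it forms a
    matrix product.\<close>
  also have "\<dots> = (\<Sum>j\<in>UNIV. \<Sum>i\<in>UNIV. \<Sum>k\<in>UNIV. S $ j $ k * R $ i $ k *
      (\<integral>z. partial i (partial j h) (R *v z) \<partial>std_normal_vec))"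
    by (intro sum.cong refl sum.swap)
  finally show ?thesis
    by (simp add: matrix_matrix_mult_def transpose_def sum_distrib_right)
qed

text \<open>With \<open>c = cos t\<close> and \<open>s = sin t\<close> the first factor is the
  velocity of the rotation and the second its position. The terms in \<open>c\<^sup>2\<close> and
  \<open>s\<^sup>2\<close> contain only products of \<open>P\<close> with \<open>Q\<close>, which
  vanish by orthogonality.\<close>

lemma rotated_matrix_mult_transpose:
  fixes P Q :: "real ^ 'm ^ 'n"
  assumes "P ** transpose Q = 0"
  shows "((- s) *\<^sub>R P + c *\<^sub>R Q) ** transpose (c *\<^sub>R P + s *\<^sub>R Q) =
    (s * c) *\<^sub>R (Q ** transpose Q - P ** transpose P)"
proof -
  have PQ: "(\<Sum>k\<in>UNIV. P $ j $ k * Q $ i $ k) = 0" for i j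
    using assms by (simp add: vec_eq_iff matrix_matrix_mult_def transpose_def)
  have "(\<Sum>k\<in>UNIV. (c * Q $ j $ k - s * P $ j $ k) * (c * P $ i $ k + s * Q $ i $ k)) =
      s * c * (\<Sum>k\<in>UNIV. Q $ j $ k * Q $ i $ k) - s * c * (\<Sum>k\<in>UNIV. P $ j $ k * P $ i $ k)
      + c\<^sup>2 * (\<Sum>k\<in>UNIV. P $ i $ k * Q $ j $ k) - s\<^sup>2 * (\<Sum>k\<in>UNIV. P $ j $ k * Q $ i $ k)" for i j
    by (simp add: sum_distrib_left flip: sum.distrib sum_subtractf)
      (simp add: algebra_simps power2_eq_square)
  then show ?thesis
    by (simp add: vec_eq_iff matrix_matrix_mult_def transpose_def PQ right_diff_distrib)
qed

text \<open>A quarter turn carries \<open>P\<close> at \<open>t = 0\<close> to \<open>Q\<close> at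
  \<open>t = pi / 2\<close>. The assumption \<open>orth\<close> makes \<open>P *v z\<close> and
  \<open>Q *v z\<close> uncorrelated, so the derivative along the turn involves only the difference
  of the two covariance matrices.\<close>

lemma gaussian_interpolation:
  fixes P Q :: "real ^ 'm ^ 'n"
  assumes h: "two_bounded_derivs h" and orth: "P ** transpose Q = 0"
  shows "\<bar>(\<integral>z. h (P *v z) \<partial>std_normal_vec) - (\<integral>z. h (Q *v z) \<partial>std_normal_vec)\<bar>
    \<le> 1 / 2 * seminorm2 h *
      (\<Sum>i\<in>UNIV. \<Sum>j\<in>UNIV. \<bar>(P ** transpose P) $ i $ j - (Q ** transpose Q) $ i $ j\<bar>)"
proof -
  interpret prob_space "std_normal_vec :: (real ^ 'm) measure"
    by (rule prob_space_std_normal_vec)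
  note diff = two_bounded_derivs_differentiable[OF h]
  note diff' = two_bounded_derivs_differentiable_partial[OF h]
  obtain C where C: "\<And>i x. \<bar>partial i h x\<bar> \<le> C"
    using two_bounded_derivs_partial_bound[OF h] by blast
  have C_nonneg: "0 \<le> C"
    using C[of undefined 0] by simp
  have [measurable]: "h \<in> borel_measurable borel" "partial j h \<in> borel_measurable borel"
    "partial i (partial j h) \<in> borel_measurable borel" for i j
    by (rule borel_measurable_differentiable[OF diff] borel_measurable_partial[OF diff]
        borel_measurable_partial[OF diff'])+
  define R where "R t = cos t *\<^sub>R P + sin t *\<^sub>R Q" for t :: real
  \<comment> \<open>\<open>S\<close> is the derivative of \<open>R\<close>, and \<open>G\<close>
    will be the derivative of \<open>F\<close>.\<close>
  define S where "S t = (- sin t) *\<^sub>R P + cos t *\<^sub>R Q" for t :: real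
  define F where "F t = (\<integral>z. h (R t *v z) \<partial>std_normal_vec)" for t
  define G where "G t = (\<integral>z. (\<Sum>j\<in>UNIV. (S t *v z) $ j * partial j h (R t *v z)) \<partial>std_normal_vec)" for t
  define K where "K = seminorm2 h *
    (\<Sum>i\<in>UNIV. \<Sum>j\<in>UNIV. \<bar>(P ** transpose P) $ i $ j - (Q ** transpose Q) $ i $ j\<bar>)"
  have int_nth: "integrable std_normal_vec (\<lambda>z. (A *v z) $ i)" for A :: "real ^ 'm ^ 'n" and i
    by (simp add: matrix_vector_mult_def integrable_std_normal_vec_nth)
  \<comment> \<open>\<open>h\<close> may be unbounded, but its bounded gradient gives at most linear
    growth.\<close>
  have int_h: "integrable std_normal_vec (\<lambda>z. h (A *v z))" for A :: "real ^ 'm ^ 'n"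
  proof (rule Bochner_Integration.integrable_bound)
    show "integrable std_normal_vec (\<lambda>z. C * (\<Sum>i\<in>UNIV. \<bar>(A *v z) $ i\<bar>) + \<bar>h 0\<bar>)"
      by (intro Bochner_Integration.integrable_add integrable_mult_right Bochner_Integration.integrable_sum
          Bochner_Integration.integrable_abs int_nth) simp
    have "\<bar>h x\<bar> \<le> C * (\<Sum>i\<in>UNIV. \<bar>x $ i\<bar>) + \<bar>h 0\<bar>" for x
      using abs_diff_le_sum_partial_bound[OF diff C, of x 0] by simp
    then show "AE z in std_normal_vec. norm (h (A *v z)) \<le> norm (C * (\<Sum>i\<in>UNIV. \<bar>(A *v z) $ i\<bar>) + \<bar>h 0\<bar>)"
      by (auto intro!: AE_I2 intro: order_trans[OF _ abs_ge_self])
  qed measurable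
  have R_mult: "R t *v z = cos t *\<^sub>R (P *v z) + sin t *\<^sub>R (Q *v z)" for t z
    by (simp add: R_def matrix_vector_mult_add_rdistrib scaleR_matrix_vector_assoc)
  have S_mult: "S t *v z = (- sin t) *\<^sub>R (P *v z) + cos t *\<^sub>R (Q *v z)" for t z
    unfolding S_def by (simp only: matrix_vector_mult_add_rdistrib scaleR_matrix_vector_assoc)
  have F_deriv: "(F has_real_derivative G t) (at t)" for t
    unfolding F_def[abs_def] G_def
  proof (rule has_real_derivative_integral)
    show "((\<lambda>s. h (R s *v z)) has_real_derivative
        (\<Sum>j\<in>UNIV. (S t *v z) $ j * partial j h (R t *v z))) (at t)" for z
    proof (rule has_real_derivative_compose_partial[OF diff])
      show "((\<lambda>s. R s *v z) has_vector_derivative S t *v z) (at t)"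
        unfolding R_mult S_mult has_vector_derivative_def
        by (auto intro!: derivative_eq_intros simp: algebra_simps)
    qed
    show "integrable std_normal_vec (\<lambda>z. C * (\<Sum>i\<in>UNIV. \<bar>(P *v z) $ i\<bar> + \<bar>(Q *v z) $ i\<bar>))"
      by (intro integrable_mult_right Bochner_Integration.integrable_sum
          Bochner_Integration.integrable_add Bochner_Integration.integrable_abs int_nth)
    \<comment> \<open>Since \<open>cos\<close> and \<open>sin\<close> are 1-Lipschitz, one
      dominating function works for all \<open>s\<close>.\<close>
    show "\<bar>h (R s *v z) - h (R t *v z)\<bar> \<le> C * (\<Sum>i\<in>UNIV. \<bar>(P *v z) $ i\<bar> + \<bar>(Q *v z) $ i\<bar>) * \<bar>s - t\<bar>" for s z
    proof -
      have cs: "\<bar>cos s - cos t\<bar> \<le> \<bar>s - t\<bar>" "\<bar>sin s - sin t\<bar> \<le> \<bar>s - t\<bar>"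
        using field_differentiable_bound[of UNIV cos "\<lambda>x. - sin x" 1 s t]
          field_differentiable_bound[of UNIV sin cos 1 s t]
        by (auto intro: DERIV_cos DERIV_sin)
      have "\<bar>(R s *v z) $ i - (R t *v z) $ i\<bar> \<le> (\<bar>(P *v z) $ i\<bar> + \<bar>(Q *v z) $ i\<bar>) * \<bar>s - t\<bar>" for i
      proof -
        have "(R s *v z) $ i - (R t *v z) $ i =
            (P *v z) $ i * (cos s - cos t) + (Q *v z) $ i * (sin s - sin t)"
          by (simp add: R_mult algebra_simps)
        also have "\<bar>\<dots>\<bar> \<le> \<bar>(P *v z) $ i\<bar> * \<bar>s - t\<bar> + \<bar>(Q *v z) $ i\<bar> * \<bar>s - t\<bar>"
          by (intro order_trans[OF abs_triangle_ineq] add_mono) (auto simp: abs_mult intro!: mult_left_mono cs)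
        finally show ?thesis
          by (simp add: distrib_right)
      qed
      then have "C * (\<Sum>i\<in>UNIV. \<bar>(R s *v z) $ i - (R t *v z) $ i\<bar>)
          \<le> C * (\<Sum>i\<in>UNIV. (\<bar>(P *v z) $ i\<bar> + \<bar>(Q *v z) $ i\<bar>) * \<bar>s - t\<bar>)"
        by (intro mult_left_mono sum_mono C_nonneg)
      then show ?thesis
        using abs_diff_le_sum_partial_bound[OF diff C, of "R s *v z" "R t *v z"]
        by (simp add: sum_distrib_right mult.assoc)
    qed
    show "(\<lambda>z. \<Sum>j\<in>UNIV. (S t *v z) $ j * partial j h (R t *v z)) \<in> borel_measurable std_normal_vec"
    proof (intro borel_measurable_sum borel_measurable_times)
      show "(\<lambda>z. (S t *v z) $ j) \<in> borel_measurable std_normal_vec" for j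
        using int_nth by (rule borel_measurable_integrable)
      show "(\<lambda>z. partial j h (R t *v z)) \<in> borel_measurable std_normal_vec" for j
        by measurable
    qed
  qed (rule int_h)
  have G_le: "\<bar>G t\<bar> \<le> sin t * cos t * K" if t: "0 \<le> t" "t \<le> pi / 2" for t
  proof -
    \<comment> \<open>On the first quadrant the factor \<open>sin t * cos t\<close> leaves the
      absolute value unchanged.\<close>
    have sc: "0 \<le> sin t" "0 \<le> cos t"
      using t by (auto intro: sin_ge_zero cos_ge_zero)
    have le: "\<bar>\<integral>z. partial i (partial j h) (R t *v z) \<partial>std_normal_vec\<bar> \<le> seminorm2 h" for i j
    proof -
      have "\<bar>\<integral>z. partial i (partial j h) (R t *v z) \<partial>std_normal_vec\<bar>
          \<le> (\<integral>z. \<bar>partial i (partial j h) (R t *v z)\<bar> \<partial>std_normal_vec)"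
        by (rule integral_abs_bound)
      also have "\<dots> \<le> seminorm2 h"
        using abs_partial_partial_le_seminorm2[OF h]
        by (intro integral_le_const integrable_std_normal_vec_bounded[where C = "seminorm2 h"]) auto
      finally show ?thesis .
    qed
    have "G t = (\<Sum>j\<in>UNIV. \<Sum>i\<in>UNIV. (S t ** transpose (R t)) $ j $ i *
        (\<integral>z. partial i (partial j h) (R t *v z) \<partial>std_normal_vec))"
      unfolding G_def by (rule integral_gradient_linear_std_normal_vec[OF h])
    also have "\<bar>\<dots>\<bar> \<le> (\<Sum>j\<in>UNIV. \<Sum>i\<in>UNIV. \<bar>(S t ** transpose (R t)) $ j $ i\<bar> * seminorm2 h)"
      by (intro order_trans[OF sum_abs] sum_mono) (auto simp: abs_mult intro!: mult_left_mono le)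
    also have "\<dots> = sin t * cos t * K"
      unfolding R_def S_def rotated_matrix_mult_transpose[OF orth] K_def
      using sc by (simp add: abs_mult abs_minus_commute sum_distrib_left sum_distrib_right mult_ac)
    finally show ?thesis .
  qed
  have sin2: "((\<lambda>t. K / 2 * (sin t)\<^sup>2) has_real_derivative sin t * cos t * K) (at t)" for t
    by (auto intro!: derivative_eq_intros simp: field_simps)
  \<comment> \<open>\<open>K / 2 * (sin t)\<^sup>2\<close> is a primitive of the bound on
    \<open>G\<close>. Adding \<open>F\<close> to it or subtracting \<open>F\<close> from it gives a
    nondecreasing function, so \<open>F\<close> changes by at most the increase \<open>K / 2\<close>
    of the primitive.\<close>
  have "F 0 + K / 2 * (sin 0)\<^sup>2 \<le> F (pi / 2) + K / 2 * (sin (pi / 2))\<^sup>2"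
  proof (rule DERIV_nonneg_imp_nondecreasing[where f = "\<lambda>t. F t + K / 2 * (sin t)\<^sup>2"])
    fix t assume "0 \<le> t" "t \<le> pi / 2"
    with DERIV_add[OF F_deriv sin2, of t] G_le[of t]
    show "\<exists>y. ((\<lambda>t. F t + K / 2 * (sin t)\<^sup>2) has_real_derivative y) (at t) \<and> 0 \<le> y"
      by (auto simp: abs_le_iff)
  qed simp
  moreover have "K / 2 * (sin 0)\<^sup>2 - F 0 \<le> K / 2 * (sin (pi / 2))\<^sup>2 - F (pi / 2)"
  proof (rule DERIV_nonneg_imp_nondecreasing[where f = "\<lambda>t. K / 2 * (sin t)\<^sup>2 - F t"])
    fix t assume "0 \<le> t" "t \<le> pi / 2"
    with DERIV_diff[OF sin2 F_deriv, of t] G_le[of t]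
    show "\<exists>y. ((\<lambda>t. K / 2 * (sin t)\<^sup>2 - F t) has_real_derivative y) (at t) \<and> 0 \<le> y"
      by (auto simp: abs_le_iff)
  qed simp
  ultimately have "\<bar>F 0 - F (pi / 2)\<bar> \<le> K / 2"
    unfolding sin_zero sin_pi_half by (simp only: abs_le_iff) simp
  then show ?thesis
    by (simp add: F_def R_def K_def)
qed

section \<open>Coupling of the two normal vectors\<close>

text \<open>The expectation depends on the law of \<open>X\<close> only, so the standard normal
  vector behind \<open>X\<close> may be replaced by a selection of coordinates of a larger
  one.\<close>

lemma integral_linear_image_std_normal_vec:
  fixes h :: "real ^ 'n \<Rightarrow> real"
  assumes X: "X \<in> borel_measurable M"
    and law: "distr M borel X = distr std_normal_vec borel (\<lambda>z. A *v z)"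
    and h[measurable]: "h \<in> borel_measurable borel" and "inj r"
  shows "(\<integral>\<omega>. h (X \<omega>) \<partial>M) = (\<integral>z. h (A *v (\<chi> i. z $ r i)) \<partial>std_normal_vec)"
proof -
  have [measurable]: "(\<lambda>z. \<chi> i. z $ r i) \<in> borel_measurable borel"
    by (intro borel_measurable_continuous_onI continuous_intros)
  have "(\<integral>\<omega>. h (X \<omega>) \<partial>M) = (\<integral>x. h x \<partial>distr M borel X)"
    using X by (simp add: integral_distr)
  also have "\<dots> = (\<integral>z. h (A *v z) \<partial>std_normal_vec)"
    unfolding law by (rule integral_distr) measurable
  also have "\<dots> = (\<integral>z. h (A *v z) \<partial>distr std_normal_vec borel (\<lambda>z. \<chi> i. z $ r i))"
    by (simp add: distr_std_normal_vec_reindex[OF \<open>inj r\<close>])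
  also have "\<dots> = (\<integral>z. h (A *v (\<chi> i. z $ r i)) \<partial>std_normal_vec)"
    by (rule integral_distr) measurable
  finally show ?thesis .
qed

theorem proposition2p8:
  fixes M :: "'a measure" and N :: "'b measure"
    and X :: "'a \<Rightarrow> real ^ 'd" and Y :: "'b \<Rightarrow> real ^ 'd"
    and \<Sigma> \<Sigma>\<^sub>0 :: "real ^ 'd ^ 'd"
    and h :: "real ^ 'd \<Rightarrow> real"
  assumes "prob_space M" and "prob_space N"
    and "has_mvn M X 0 \<Sigma>" and "has_mvn N Y 0 \<Sigma>\<^sub>0"
    and "rank \<Sigma> = CARD('d)"
    and "nonneg_definite \<Sigma>\<^sub>0"
    and "two_bounded_derivs h"
  shows "\<bar>prob_space.expectation M (\<lambda>\<omega>. h (X \<omega>)) - prob_space.expectation N (\<lambda>\<omega>. h (Y \<omega>))\<bar>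
    \<le> 1 / 2 * seminorm2 h * (\<Sum>i\<in>UNIV. \<Sum>j\<in>UNIV. \<bar>\<Sigma> $ i $ j - \<Sigma>\<^sub>0 $ i $ j\<bar>)"
proof -
  obtain A :: "real ^ 'd ^ 'd" where X: "X \<in> borel_measurable M" and A: "A ** transpose A = \<Sigma>"
    and X_law: "distr M borel X = distr std_normal_vec borel (\<lambda>z. A *v z)"
    using assms(3) by (auto simp: has_mvn_def)
  obtain B :: "real ^ 'd ^ 'd" where Y: "Y \<in> borel_measurable N" and B: "B ** transpose B = \<Sigma>\<^sub>0"
    and Y_law: "distr N borel Y = distr std_normal_vec borel (\<lambda>z. B *v z)"
    using assms(4) by (auto simp: has_mvn_def)
  have h_meas: "h \<in> borel_measurable borel"
    using two_bounded_derivs_differentiable[OF assms(7)] by (rule borel_measurable_differentiable)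
  \<comment> \<open>The block matrices \<open>[A 0]\<close> and \<open>[0 B]\<close> use disjoint
    halves of the coordinates. This is the independent coupling of the two laws, whatever spaces
    \<open>X\<close> and \<open>Y\<close> live on, and it makes \<open>P ** transpose Q\<close>
    vanish.\<close>
  define P :: "real ^ ('d + 'd) ^ 'd" where "P = (\<chi> i k. case k of Inl j \<Rightarrow> A $ i $ j | Inr j \<Rightarrow> 0)"
  define Q :: "real ^ ('d + 'd) ^ 'd" where "Q = (\<chi> i k. case k of Inl j \<Rightarrow> 0 | Inr j \<Rightarrow> B $ i $ j)"
  have sum_Plus: "(\<Sum>k\<in>UNIV. f k) = (\<Sum>j\<in>UNIV. f (Inl j)) + (\<Sum>j\<in>UNIV. f (Inr j))"
    for f :: "'d + 'd \<Rightarrow> real"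
    by (subst UNIV_Plus_UNIV[symmetric], subst sum.Plus) auto
  have P: "P *v z = A *v (\<chi> i. z $ Inl i)" and Q: "Q *v z = B *v (\<chi> i. z $ Inr i)" for z
    by (simp_all add: vec_eq_iff matrix_vector_mult_def P_def Q_def sum_Plus)
  have "P ** transpose Q = 0" "P ** transpose P = \<Sigma>" "Q ** transpose Q = \<Sigma>\<^sub>0"
    by (simp_all add: vec_eq_iff matrix_matrix_mult_def transpose_def P_def Q_def sum_Plus
        flip: A B)
  with gaussian_interpolation[OF assms(7), of P Q]
    integral_linear_image_std_normal_vec[OF X X_law h_meas, of "Inl :: 'd \<Rightarrow> 'd + 'd"]
    integral_linear_image_std_normal_vec[OF Y Y_law h_meas, of "Inr :: 'd \<Rightarrow> 'd + 'd"]
  show ?thesis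
    by (simp add: P Q)
qed

end
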